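(* Let $\mathcal{H}$ be a separable Hilbert space, let $g\in\mathcal{H}$, and let $A$ and $B$ be bounded linear operators on $\mathcal{H}$. Suppose that: (i) any $f\in\mathcal{H}$ is recovered from the samples $\{\langle A^n f,g\rangle\}_{n\ge 0}$ in a stable way; (ii) for each positive real number $k$, there exist constants $\lambda_1,\lambda_2\ge 0$ such that $\max\{\lambda_1,\lambda_2\}<\min\{1,2^{k-1}\}$ and, for all $l\in\mathbb{Z}^+$ and all scalars $a_0,\dots,a_l$, $$\Big\|\sum_{n=0}^{l}a_n\big((A^* )^n-(B^* )^n\big)g\Big\|\le\left[\lambda_1\Big\|\sum_{n=0}^{l}a_n(A^* )^n g\Big\|^k+\lambda_2\Big\|\sum_{n=0}^{l}a_n(B^* )^n g\Big\|^k\right]^{1/k}.$$ Then any $f\in\mathcal{H}$ can also be recovered from the samples $\{\langle B^n f,g\rangle\}_{n\ge 0}$ in a stable way.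
   Context: $\mathbb{Z}^+=\{0,1,2,\dots\}$, and $A^*,B^*$ denote the Hilbert-space adjoints of $A,B$. For a bounded linear operator $C$ on $\mathcal{H}$ and a vector $u\in\mathcal{H}$, "any $f\in\mathcal{H}$ is (can be) recovered from the samples $\{\langle C^n f,u\rangle\}_{n\ge 0}$ in a stable way" means: for every $f\in\mathcal{H}$ the sequence $\{\langle C^n f,u\rangle\}_{n\ge0}$ belongs to $\ell^2(\mathbb{Z}^+)$, and there exists a bounded linear operator $\mathscr{R}:\ell^2(\mathbb{Z}^+)\to\mathcal{H}$ such that $\mathscr{R}(\{\langle C^n f,u\rangle\}_{n\ge0})=f$ for all $f\in\mathcal{H}$. *)

theory Defs
  imports "HOL-Analysis.Analysis"
begin

text \<open>
  The scalar field of a Hilbert space is the real or the complex numbers. The two cases are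
  treated uniformly: by the Gelfand--Mazur theorem every real normed field is isomorphic to one
  of these two, and the axioms below force \<^term>\<open>sconj\<close> to be the usual conjugation
  (the identity in the real case), since \<open>sconj a = \<bar>a\<bar>\<^sup>2 / a\<close> for \<open>a \<noteq> 0\<close>.
\<close>

class real_or_complex = real_normed_field +
  fixes sconj :: "'a \<Rightarrow> 'a"
  assumes sconj_add: "sconj (a + b) = sconj a + sconj b"
    and mult_sconj: "a * sconj a = (norm a)\<^sup>2 *\<^sub>R 1"

instantiation real :: real_or_complex
begin
definition sconj_real :: "real \<Rightarrow> real" where "sconj_real a = a"
instance by standard (simp_all add: sconj_real_def power2_eq_square)
end

instantiation complex :: real_or_complex
begin
definition sconj_complex :: "complex \<Rightarrow> complex" where "sconj_complex a = cnj a"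
instance by standard (simp_all only: sconj_complex_def complex_cnj_add complex_norm_square
    scaleR_conv_of_real mult_1_right flip: of_real_power)
end

text \<open>
  A Hilbert space over \<open>'k\<close>. Completeness comes from the class \<^class>\<open>banach\<close>; the axiom
  \<open>ip_self\<close> says that the norm is the one induced by the inner product (and so contains positive
  definiteness). The inner product is linear in its first argument.
\<close>

locale hilbert_space = vector_space scaleK
  for scaleK :: "'k::real_or_complex \<Rightarrow> 'h::banach \<Rightarrow> 'h" +
  fixes ip :: "'h \<Rightarrow> 'h \<Rightarrow> 'k"
  assumes scale_of_real: "scaleK (of_real r) x = r *\<^sub>R x"
    and ip_add_left: "ip (x + y) z = ip x z + ip y z"
    and ip_scale_left: "ip (scaleK c x) y = c * ip x y"
    and ip_commute: "ip y x = sconj (ip x y)"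
    and ip_self: "ip x x = of_real ((norm x)\<^sup>2)"

lemma hilbert_space_real:
  "hilbert_space (scaleR :: real \<Rightarrow> 'h::{real_inner, banach} \<Rightarrow> 'h) inner"
  by unfold_locales
    (simp_all add: sconj_real_def inner_add_left inner_commute power2_norm_eq_inner algebra_simps)

lemma hilbert_space_complex:
  "hilbert_space ((*) :: complex \<Rightarrow> complex \<Rightarrow> complex) (\<lambda>x y. x * cnj y)"
  by unfold_locales
    (simp_all only: sconj_complex_def complex_norm_square scaleR_conv_of_real complex_cnj_mult
      complex_cnj_cnj, simp_all add: algebra_simps)

definition bounded_operator ::
  "('k::real_or_complex \<Rightarrow> 'h::banach \<Rightarrow> 'h) \<Rightarrow> ('h \<Rightarrow> 'h) \<Rightarrow> bool" where
  "bounded_operator scaleK C \<longleftrightarrow>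
     Vector_Spaces.linear scaleK scaleK C \<and> (\<exists>K. \<forall>x. norm (C x) \<le> K * norm x)"

text \<open>
  For a bounded operator on a Hilbert space the adjoint exists and is unique, so the definite
  description is well defined in that case.
\<close>

definition hilbert_adjoint :: "('h \<Rightarrow> 'h \<Rightarrow> 'k) \<Rightarrow> ('h \<Rightarrow> 'h) \<Rightarrow> 'h \<Rightarrow> 'h" where
  "hilbert_adjoint ip C = (THE C'. \<forall>x y. ip (C x) y = ip x (C' y))"

definition ell2 :: "(nat \<Rightarrow> 'k::real_or_complex) set" where
  "ell2 = {a. summable (\<lambda>n. (norm (a n))\<^sup>2)}"

definition ell2_norm :: "(nat \<Rightarrow> 'k::real_or_complex) \<Rightarrow> real" where
  "ell2_norm a = sqrt (\<Sum>n. (norm (a n))\<^sup>2)"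

text \<open>
  Bounded linear operators from \<^term>\<open>ell2\<close> to the Hilbert space are represented by functions
  on all sequences; only the values on \<^term>\<open>ell2\<close> matter.
\<close>

definition bounded_linear_ell2 ::
  "('k::real_or_complex \<Rightarrow> 'h::banach \<Rightarrow> 'h) \<Rightarrow> ((nat \<Rightarrow> 'k) \<Rightarrow> 'h) \<Rightarrow> bool" where
  "bounded_linear_ell2 scaleK R \<longleftrightarrow>
     (\<forall>a\<in>ell2. \<forall>b\<in>ell2. R (\<lambda>n. a n + b n) = R a + R b) \<and>
     (\<forall>c. \<forall>a\<in>ell2. R (\<lambda>n. c * a n) = scaleK c (R a)) \<and>
     (\<exists>K. \<forall>a\<in>ell2. norm (R a) \<le> K * ell2_norm a)"

definition stably_recoverable ::
  "('k::real_or_complex \<Rightarrow> 'h::banach \<Rightarrow> 'h) \<Rightarrow> ('h \<Rightarrow> 'h \<Rightarrow> 'k) \<Rightarrow> ('h \<Rightarrow> 'h) \<Rightarrow> 'h \<Rightarrow> bool" where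
  "stably_recoverable scaleK ip C u \<longleftrightarrow>
     (\<forall>f. (\<lambda>n. ip ((C ^^ n) f) u) \<in> ell2) \<and>
     (\<exists>R. bounded_linear_ell2 scaleK R \<and> (\<forall>f. R (\<lambda>n. ip ((C ^^ n) f) u) = f))"

end

theory Submission
  imports Defs
begin

text \<open>
  Put \<open>f\<^sub>n = (A\<^sup>*)\<^sup>n g\<close> and \<open>g\<^sub>n = (B\<^sup>*)\<^sup>n g\<close>, so that the samples of \<open>h\<close> are the analysis
  coefficients \<open>\<langle>h, f\<^sub>n\<rangle>\<close> and \<open>\<langle>h, g\<^sub>n\<rangle>\<close>. The recovery operator of \<open>A\<close> has the form
  \<open>R c = \<Sum> c\<^sub>n r\<^sub>n\<close>, and dually \<open>\<Sum> \<langle>h, r\<^sub>n\<rangle> f\<^sub>n = h\<close>. With \<open>G = \<Sum> \<langle>h, r\<^sub>n\<rangle> g\<^sub>n\<close> the hypothesis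
  for \<open>k = 2\<close> gives \<open>\<parallel>h - G\<parallel>\<^sup>2 \<le> \<lambda> (\<parallel>h\<parallel>\<^sup>2 + \<parallel>G\<parallel>\<^sup>2)\<close> with \<open>\<lambda> < 1\<close>, hence
  \<open>2 Re \<langle>h, G\<rangle> \<ge> (1 - \<lambda>) \<parallel>h\<parallel>\<^sup>2\<close>. As \<open>\<langle>h, G\<rangle> = \<langle>M h, h\<rangle>\<close> with
  \<open>M h = R (\<langle>h, g\<^sub>n\<rangle>)\<^sub>n\<close>, the operator \<open>M\<close> is coercive, so it is invertible, and \<open>M\<^sup>-\<^sup>1 R\<close> recovers
  \<open>h\<close> from the samples of \<open>B\<close>.
\<close>

section \<open>Conjugation in the scalar field\<close>

lemma sconj_0 [simp]: "sconj 0 = (0 :: 'k::real_or_complex)"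
  using sconj_add[of 0 "0::'k"] by simp

lemma mult_sconj_of_real: "c * sconj c = of_real ((norm c)\<^sup>2)" for c :: "'k::real_or_complex"
  by (simp add: mult_sconj scaleR_conv_of_real)

lemma norm_sconj [simp]: "norm (sconj c) = norm c" for c :: "'k::real_or_complex"
proof (cases "c = 0")
  case False
  have "norm (c * sconj c) = (norm c)\<^sup>2"
    by (simp add: mult_sconj_of_real norm_power)
  with False show ?thesis
    by (simp add: norm_mult power2_eq_square)
qed simp

text \<open>In a field, a nonzero \<open>c\<close> admits only one \<open>d\<close> whose product
  with \<open>c\<close> is the squared norm of \<open>c\<close>. Multiplicativity of
  \<open>sconj\<close> and its triviality on reals, which are not class axioms, follow from this
  uniqueness.\<close>

lemma sconj_eqI: "sconj c = d" if "c \<noteq> 0" "c * d = of_real ((norm c)\<^sup>2)" for c :: "'k::real_or_complex"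
  using that mult_sconj_of_real[of c] by (metis mult_left_cancel)

lemma sconj_mult: "sconj (c * d) = sconj c * sconj d" for c :: "'k::real_or_complex"
proof (cases "c * d = 0")
  case False
  have "c * d * (sconj c * sconj d) = (c * sconj c) * (d * sconj d)"
    by (simp add: mult_ac)
  also have "\<dots> = of_real ((norm (c * d))\<^sup>2)"
    by (simp add: mult_sconj_of_real norm_mult power_mult_distrib)
  finally show ?thesis
    using False by (intro sconj_eqI) auto
qed auto

lemma sconj_of_real [simp]: "sconj (of_real r) = (of_real r :: 'k::real_or_complex)"
  by (cases "r = 0") (auto intro!: sconj_eqI simp: power2_eq_square)

section \<open>Square-summable sequences, their truncations and tails\<close>

lemma L2_set_le_ell2_norm:
  assumes "c \<in> ell2"
  shows "L2_set (\<lambda>n. norm (c n)) {..<N} \<le> ell2_norm c"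
  unfolding ell2_norm_def L2_set_def
  using assms by (intro real_sqrt_le_mono sum_le_suminf) (auto simp: ell2_def)

lemma ell2_iff_L2_set_bounded:
  "c \<in> ell2 \<longleftrightarrow> (\<exists>K. \<forall>N. L2_set (\<lambda>n. norm (c n)) {..<N} \<le> K)"
proof
  assume "c \<in> ell2"
  then show "\<exists>K. \<forall>N. L2_set (\<lambda>n. norm (c n)) {..<N} \<le> K"
    using L2_set_le_ell2_norm by blast
next
  assume "\<exists>K. \<forall>N. L2_set (\<lambda>n. norm (c n)) {..<N} \<le> K"
  then obtain K where K: "\<And>N. L2_set (\<lambda>n. norm (c n)) {..<N} \<le> K"
    by blast
  have "(\<Sum>n<N. (norm (c n))\<^sup>2) \<le> K\<^sup>2" for N
    using K[of N] by (intro sqrt_le_D) (simp add: L2_set_def)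
  then show "c \<in> ell2"
    unfolding ell2_def mem_Collect_eq by (intro summableI_nonneg_bounded[of _ "K\<^sup>2"]) auto
qed

lemma ell2_norm_le:
  assumes "\<And>N. L2_set (\<lambda>n. norm (c n)) {..<N} \<le> K"
  shows "ell2_norm c \<le> K"
proof -
  have "summable (\<lambda>n. (norm (c n))\<^sup>2)"
    using assms ell2_iff_L2_set_bounded[of c] by (auto simp: ell2_def)
  moreover have "(\<Sum>n<N. (norm (c n))\<^sup>2) \<le> K\<^sup>2" for N
    using assms[of N] by (intro sqrt_le_D) (simp add: L2_set_def)
  ultimately have "(\<Sum>n. (norm (c n))\<^sup>2) \<le> K\<^sup>2"
    by (intro suminf_le_const)
  moreover have "0 \<le> K"
    using assms[of 0] by simp
  ultimately show ?thesis
    unfolding ell2_norm_def by (simp add: real_le_lsqrt)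
qed

lemma ell2_truncate: "(\<lambda>n. if n < N then c n else 0) \<in> ell2"
  unfolding ell2_def mem_Collect_eq by (rule summable_finite[of "{..<N}"]) auto

lemma ell2_tail:
  assumes "c \<in> ell2"
  shows "(\<lambda>n. if n < N then 0 else c n) \<in> ell2"
  using assms unfolding ell2_def
  by (auto intro: summable_comparison_test'[where N = 0 and g = "\<lambda>n. (norm (c n))\<^sup>2"])

text \<open>After its leading zeros are dropped, the series of the tail is the remainder of a
  convergent series. This is the source of convergence for all expansions over \<open>ell2\<close>
  below.\<close>

lemma ell2_norm_tail_tendsto:
  assumes "c \<in> ell2"
  shows "(\<lambda>N. ell2_norm (\<lambda>n. if n < N then 0 else c n)) \<longlonglongrightarrow> 0"
proof -
  have s: "summable (\<lambda>n. (norm (c n))\<^sup>2)"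
    using assms by (simp add: ell2_def)
  have "(\<Sum>n. (norm (if n < N then 0 else c n))\<^sup>2) = (\<Sum>n. (norm (c (n + N)))\<^sup>2)" for N
    using ell2_tail[OF assms, of N]
      suminf_split_initial_segment[of "\<lambda>n. (norm (if n < N then 0 else c n))\<^sup>2" N]
    by (simp add: ell2_def)
  then show ?thesis
    unfolding ell2_norm_def
    using tendsto_real_sqrt[OF suminf_exist_split2[OF s]] by simp
qed

section \<open>Inner product calculus and the Cauchy-Schwarz inequality\<close>

context hilbert_space
begin

lemma ip_add_right: "ip x (y + z) = ip x y + ip x z"
  by (metis ip_add_left ip_commute sconj_add)

lemma ip_scale_right: "ip x (scaleK c y) = sconj c * ip x y"
  by (metis ip_commute ip_scale_left sconj_mult)

lemma scaleR_eq_scaleK: "r *\<^sub>R x = scaleK (of_real r) x"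
  by (simp add: scale_of_real)

lemma ip_minus_left: "ip (- x) y = - ip x y"
  using ip_scale_left[of "-1" x y] by simp

lemma ip_diff_left: "ip (x - y) z = ip x z - ip y z"
  using ip_add_left[of x "- y" z] by (simp add: ip_minus_left)

lemma ip_zero_left [simp]: "ip 0 x = 0"
  using ip_scale_left[of 0 0 x] by simp

lemma ip_zero_right [simp]: "ip x 0 = 0"
  using ip_scale_right[of x 0 0] by simp

lemma ip_sum_left: "ip (sum f I) y = (\<Sum>i\<in>I. ip (f i) y)"
  by (induction I rule: infinite_finite_induct) (auto simp: ip_add_left)

lemma ip_sum_right: "ip x (sum f I) = (\<Sum>i\<in>I. ip x (f i))"
  by (induction I rule: infinite_finite_induct) (auto simp: ip_add_right)

text \<open>The norm of \<open>'h\<close> is a priori homogeneous for real scalars only; for the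
  scalars in \<open>'k\<close> this comes from \<open>ip_self\<close>.\<close>

lemma norm_scaleK: "norm (scaleK c x) = norm c * norm x"
proof -
  have "of_real ((norm (scaleK c x))\<^sup>2) = (c * sconj c) * ip x x"
    by (simp only: ip_scale_left ip_scale_right mult_ac flip: ip_self)
  also have "\<dots> = (of_real ((norm c * norm x)\<^sup>2) :: 'k)"
    by (simp add: mult_sconj_of_real ip_self power_mult_distrib)
  finally have "(norm (scaleK c x))\<^sup>2 = (norm c * norm x)\<^sup>2"
    by (metis of_real_eq_iff)
  then show ?thesis
    by simp
qed

text \<open>The real part of \<open>ip\<close>, by polarisation, since \<open>real_or_complex\<close> provides no real-part
  function.\<close>

definition rip :: "'h \<Rightarrow> 'h \<Rightarrow> real" where
  "rip x y = ((norm (x + y))\<^sup>2 - (norm x)\<^sup>2 - (norm y)\<^sup>2) / 2"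

lemma of_real_rip: "of_real (rip x y) = (ip x y + ip y x) / 2"
  by (simp add: rip_def ip_add_left ip_add_right flip: of_real_power add: ip_self[symmetric])

lemma rip_eqI: "rip x y = r" if "ip x y + ip y x = 2 * of_real r"
proof -
  have "of_real (rip x y) = (of_real r :: 'k)"
    using that by (simp add: of_real_rip)
  then show ?thesis
    by (metis of_real_eq_iff)
qed

lemma double_rip: "ip x y + ip y x = 2 * of_real (rip x y)"
  by (simp add: of_real_rip)

lemma rip_eq_of_ip: "rip x y = r" if "ip x y = of_real r"
  using that by (intro rip_eqI) (simp add: ip_commute[of y x])

text \<open>The polarised form mentions norms of the separate vectors; written as half the sum of
  \<open>ip x y\<close> and its conjugate, it depends on the value of \<open>ip\<close>
  alone.\<close>

lemma rip_cong_ip: "rip x y = rip u v" if "ip x y = ip u v"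
  using that by (intro rip_eqI) (simp add: ip_commute[of y x] ip_commute[of v u] flip: double_rip)

lemma rip_commute: "rip x y = rip y x"
  by (simp add: rip_def add.commute)

lemma rip_add_left: "rip (x + y) z = rip x z + rip y z"
  by (rule rip_eqI) (simp add: ip_add_left ip_add_right distrib_left add_ac flip: double_rip)

lemma rip_scaleR_left: "rip (r *\<^sub>R x) y = r * rip x y"
  by (rule rip_eqI)
    (simp add: scaleR_eq_scaleK ip_scale_left ip_scale_right mult.left_commute[of 2]
      flip: double_rip distrib_left)

lemma rip_scaleR_right: "rip x (r *\<^sub>R y) = r * rip x y"
  by (metis rip_scaleR_left rip_commute)

lemma rip_minus_left: "rip (- x) y = - rip x y"
  using rip_scaleR_left[of "-1"] by simp

lemma norm_add_squared: "(norm (x + y))\<^sup>2 = (norm x)\<^sup>2 + 2 * rip x y + (norm y)\<^sup>2"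
  by (simp add: rip_def field_simps)

lemma norm_diff_squared: "(norm (x - y))\<^sup>2 = (norm x)\<^sup>2 - 2 * rip x y + (norm y)\<^sup>2"
  using norm_add_squared[of x "- y"] rip_minus_left[of y x] by (simp add: rip_commute)

text \<open>The triangle inequality is already available for the norm; squaring it leaves exactly
  this bound on the cross term.\<close>

lemma rip_le_norm: "rip x y \<le> norm x * norm y"
proof -
  have "(norm (x + y))\<^sup>2 \<le> (norm x + norm y)\<^sup>2"
    by (intro power_mono norm_triangle_ineq) simp
  then show ?thesis
    by (simp add: norm_add_squared power2_sum)
qed

text \<open>Cauchy-Schwarz: multiplying \<open>x\<close> by a scalar of norm 1 makes the inner
  product real and nonnegative, which reduces the claim to \<open>rip_le_norm\<close>.\<close>

lemma norm_ip_le: "norm (ip x y) \<le> norm x * norm y"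
proof (cases "ip x y = 0")
  case False
  define c where "c = sconj (ip x y) / of_real (norm (ip x y))"
  have "ip (scaleK c x) y = (ip x y * sconj (ip x y)) / of_real (norm (ip x y))"
    by (simp add: ip_scale_left c_def mult.commute)
  also have "\<dots> = of_real (norm (ip x y))"
    using False by (simp add: mult_sconj_of_real power2_eq_square)
  finally have "norm (ip x y) = rip (scaleK c x) y"
    by (metis rip_eq_of_ip)
  also have "\<dots> \<le> norm (scaleK c x) * norm y"
    by (rule rip_le_norm)
  also have "norm (scaleK c x) = norm x"
    using False by (simp add: norm_scaleK c_def norm_divide)
  finally show ?thesis .
qed simp

lemma bounded_linear_ip_left: "bounded_linear (\<lambda>x. ip x y)"
  by (rule bounded_linear_intro[where K = "norm y"])
    (auto simp: ip_add_left scaleR_eq_scaleK ip_scale_left scaleR_conv_of_real norm_ip_le)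

lemma bounded_linear_ip_right: "bounded_linear (\<lambda>y. ip x y)"
  by (rule bounded_linear_intro[where K = "norm x"])
    (auto simp: ip_add_right scaleR_eq_scaleK ip_scale_right scaleR_conv_of_real norm_ip_le
      mult.commute[of "norm x"] intro: order_trans[OF norm_ip_le])

lemmas tendsto_ip_left = bounded_linear.tendsto[OF bounded_linear_ip_left]
lemmas tendsto_ip_right = bounded_linear.tendsto[OF bounded_linear_ip_right]

lemma ip_eqI: "x = y" if "\<And>z. ip x z = ip y z"
proof -
  have "ip (x - y) (x - y) = 0"
    using that by (simp add: ip_diff_left)
  then show ?thesis
    by (simp add: ip_self)
qed

section \<open>Riesz representation and adjoints\<close>

text \<open>The representing vector is the minimiser of the energy \<open>\<parallel>x\<parallel>\<^sup>2 - 2 \<phi> x\<close>; by the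
  parallelogram law every minimising sequence is Cauchy.\<close>

lemma riesz_representation_real:
  fixes \<phi> :: "'h \<Rightarrow> real"
  assumes "bounded_linear \<phi>"
  shows "\<exists>z. \<forall>x. \<phi> x = rip x z"
proof -
  interpret \<phi>: bounded_linear \<phi> by fact
  obtain K where K: "\<And>x. norm (\<phi> x) \<le> norm x * K"
    using \<phi>.bounded by blast
  define J where "J x = (norm x)\<^sup>2 - 2 * \<phi> x" for x
  define d where "d = (INF x. J x)"
  have "- K\<^sup>2 \<le> J x" for x
  proof -
    have "0 \<le> (norm x - K)\<^sup>2" by simp
    with K[of x] show ?thesis
      by (simp add: J_def power2_diff)
  qed
  then have bdd: "bdd_below (range J)"
    by (intro bdd_belowI2)
  then have d_le: "d \<le> J x" for x
    unfolding d_def by (intro cINF_lower) auto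
  have close: "\<exists>x. J x < d + 1 / real (Suc n)" for n
    using bdd cINF_less_iff[of UNIV J "d + 1 / real (Suc n)"] by (auto simp: d_def)
  then obtain X where X: "\<And>n. J (X n) < d + 1 / real (Suc n)"
    by metis
  \<comment> \<open>Parallelogram law in terms of the energy: the contributions of
    \<open>\<phi>\<close> cancel by linearity.\<close>
  have par: "(norm (x - y))\<^sup>2 = 2 * J x + 2 * J y - 4 * J ((1/2) *\<^sub>R (x + y))" for x y
    by (simp add: J_def \<phi>.add \<phi>.scale power_mult_distrib power_divide norm_add_squared
        norm_diff_squared rip_scaleR_left rip_scaleR_right field_simps)
  \<comment> \<open>Both energies exceed \<open>d\<close> by less than
    \<open>1 / real (Suc N)\<close>, and the energy of the midpoint is at least
    \<open>d\<close>.\<close>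
  have bound: "(norm (X m - X n))\<^sup>2 < 4 / real (Suc N)" if "N \<le> m" "N \<le> n" for m n N
  proof -
    have "1 / real (Suc m) \<le> 1 / real (Suc N)" "1 / real (Suc n) \<le> 1 / real (Suc N)"
      using that by (auto intro!: divide_left_mono)
    with X[of m] X[of n] d_le[of "(1/2) *\<^sub>R (X m + X n)"] show ?thesis
      unfolding par by argo
  qed
  have "Cauchy X"
  proof (rule metric_CauchyI)
    fix e :: real assume "0 < e"
    then obtain N where N: "4 / e\<^sup>2 < real (Suc N)"
      by (metis reals_Archimedean2 less_trans lessI of_nat_less_iff)
    have "4 / real (Suc N) < e\<^sup>2"
      using N \<open>0 < e\<close> by (simp add: field_simps)
    have "dist (X m) (X n) < e" if "N \<le> m" "N \<le> n" for m n
    proof -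
      have "(norm (X m - X n))\<^sup>2 < e\<^sup>2"
        using bound[OF that] \<open>4 / real (Suc N) < e\<^sup>2\<close> by linarith
      then show ?thesis
        using \<open>0 < e\<close> by (simp add: dist_norm power_less_imp_less_base)
    qed
    then show "\<exists>N. \<forall>m\<ge>N. \<forall>n\<ge>N. dist (X m) (X n) < e"
      by blast
  qed
  then obtain z where z: "X \<longlonglongrightarrow> z"
    using Cauchy_convergent convergent_def by blast
  have "(\<lambda>n. J (X n)) \<longlonglongrightarrow> J z"
    unfolding J_def by (intro tendsto_intros \<phi>.tendsto z)
  moreover have "(\<lambda>n. d + 1 / real (Suc n)) \<longlonglongrightarrow> d + 0"
    by (intro tendsto_intros LIMSEQ_Suc lim_1_over_n)
  ultimately have "J z \<le> d + 0"
    by (rule LIMSEQ_le) (use X less_imp_le in blast)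
  then have min: "J z \<le> J x" for x
    using d_le[of x] by simp
  have "\<phi> x = rip x z" for x
  proof (cases "x = 0")
    case False
    define s where "s = \<phi> x - rip x z"
    \<comment> \<open>This \<open>t\<close> minimises the quadratic polynomial
      \<open>J (z + t *\<^sub>R x)\<close>, so a nonzero \<open>s\<close> would push the energy
      strictly below its minimum.\<close>
    define t where "t = s / (norm x)\<^sup>2"
    have "J (z + t *\<^sub>R x) = J z + t\<^sup>2 * (norm x)\<^sup>2 - 2 * t * s"
      by (simp add: J_def norm_add_squared \<phi>.add \<phi>.scale s_def rip_scaleR_right rip_commute[of z]
          power_mult_distrib algebra_simps)
    also have "\<dots> = J z - s\<^sup>2 / (norm x)\<^sup>2"
      using False by (simp add: t_def field_simps power2_eq_square)
    finally have "s\<^sup>2 / (norm x)\<^sup>2 \<le> 0"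
      using min[of "z + t *\<^sub>R x"] by simp
    then have "s = 0"
      using False by (simp add: divide_le_0_iff)
    then show ?thesis
      by (simp add: s_def)
  qed (simp add: \<phi>.zero rip_def)
  then show ?thesis
    by blast
qed

lemma bounded_operatorD:
  assumes "bounded_operator scaleK C"
  shows "C (x + y) = C x + C y" "C (scaleK c x) = scaleK c (C x)" "bounded_linear C"
proof -
  interpret C: Vector_Spaces.linear scaleK scaleK C
    using assms by (simp add: bounded_operator_def)
  show "C (x + y) = C x + C y" "C (scaleK c x) = scaleK c (C x)"
    by (simp_all add: C.add C.scale)
  obtain K where "\<And>x. norm (C x) \<le> K * norm x"
    using assms by (auto simp: bounded_operator_def)
  then show "bounded_linear C"
    by (intro bounded_linear_intro[where K = K])
      (simp_all add: C.add C.scale scaleR_eq_scaleK mult.commute)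
qed

text \<open>Riesz representation of the real functional \<open>rip (C x) y\<close> yields the
  candidate vector; the identity of real parts, valid for all \<open>x\<close>, is then upgraded to
  an identity of scalars. Uniqueness makes the definite description denote this map.\<close>

lemma hilbert_adjoint:
  assumes C: "bounded_operator scaleK C"
  shows "ip (C x) y = ip x (hilbert_adjoint ip C y)"
proof -
  have "\<exists>z. \<forall>x. ip (C x) y = ip x z" for y
  proof -
    have "bounded_linear (\<lambda>x. rip x y)"
    proof (rule bounded_linear_intro[where K = "norm y"])
      show "norm (rip x y) \<le> norm x * norm y" for x
        using rip_le_norm[of x y] rip_le_norm[of "- x" y] by (simp add: rip_minus_left)
    qed (simp_all add: rip_add_left rip_scaleR_left)
    then have "bounded_linear (\<lambda>x. rip (C x) y)"
      using bounded_operatorD(3)[OF C] by (rule bounded_linear_compose)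
    then obtain z where z: "\<And>x. rip (C x) y = rip x z"
      using riesz_representation_real by blast
    have "ip (C x) y = ip x z" for x
    proof -
      \<comment> \<open>Testing with the multiple of \<open>x\<close> by \<open>sconj w\<close>
        turns the defect \<open>w\<close> into its squared norm. This is real, so equality of the
        real parts forces it to vanish.\<close>
      define w where "w = ip (C x) y - ip x z"
      define u where "u = scaleK (sconj w) x"
      have "ip (C u) y = ip u z + of_real ((norm w)\<^sup>2)"
        by (simp only: u_def bounded_operatorD(2)[OF C] ip_scale_left flip: mult_sconj_of_real)
          (simp add: w_def algebra_simps)
      moreover from this have "ip y (C u) = ip z u + of_real ((norm w)\<^sup>2)"
        by (metis ip_commute sconj_add sconj_of_real)
      ultimately have "ip (C u) y + ip y (C u) = (ip u z + ip z u) + 2 * of_real ((norm w)\<^sup>2)"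
        by simp
      also have "\<dots> = 2 * of_real (rip u z + (norm w)\<^sup>2)"
        by (simp add: double_rip distrib_left)
      finally have "rip (C u) y = rip u z + (norm w)\<^sup>2"
        by (rule rip_eqI)
      then show ?thesis
        by (simp add: z w_def)
    qed
    then show ?thesis
      by blast
  qed
  then obtain C' where C': "\<forall>x y. ip (C x) y = ip x (C' y)"
    by metis
  have "hilbert_adjoint ip C = C'"
    unfolding hilbert_adjoint_def
  proof (rule the_equality)
    fix D assume "\<forall>x y. ip (C x) y = ip x (D y)"
    with C' have "ip x (D y) = ip x (C' y)" for x y
      by metis
    then have "ip (D y) x = ip (C' y) x" for x y
      by (metis ip_commute)
    then show "D = C'"
      by (intro ext ip_eqI)
  qed (fact C')
  with C' show ?thesis
    by simp
qed

text \<open>Turns the samples along powers of \<open>C\<close> into analysis coefficients against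
  the orbit of \<open>y\<close> under the adjoint.\<close>

lemma ip_funpow_adjoint:
  assumes "bounded_operator scaleK C"
  shows "ip ((C ^^ n) x) y = ip x ((hilbert_adjoint ip C ^^ n) y)"
proof (induction n arbitrary: x)
  case (Suc n)
  have "ip ((C ^^ Suc n) x) y = ip (C x) ((hilbert_adjoint ip C ^^ n) y)"
    by (simp add: funpow_Suc_right Suc.IH del: funpow.simps)
  then show ?case
    by (simp add: hilbert_adjoint[OF assms])
qed simp

section \<open>Invertibility of coercive operators\<close>

text \<open>The Richardson iteration \<open>x \<mapsto> x - t (M x - y)\<close> with small \<open>t\<close> is a contraction.\<close>

lemma coercive_bij:
  assumes M: "bounded_linear M" and "c > 0"
    and coercive: "\<And>x. c * (norm x)\<^sup>2 \<le> rip (M x) x"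
  shows "bij M" "c * norm x \<le> norm (M x)"
proof -
  interpret M: bounded_linear M by fact
  have lower: "c * norm x \<le> norm (M x)" for x
  proof (cases "x = 0")
    case False
    have "(c * norm x) * norm x \<le> norm (M x) * norm x"
      using coercive[of x] rip_le_norm[of "M x" x] by (simp add: power2_eq_square)
    then show ?thesis
      using False by simp
  qed (simp add: M.zero)
  then show "c * norm x \<le> norm (M x)" .
  have "inj M"
  proof (rule injI)
    fix x y assume "M x = M y"
    then have "M (x - y) = 0"
      by (simp add: M.diff)
    with lower[of "x - y"] \<open>c > 0\<close> show "x = y"
      by (simp add: mult_le_0_iff)
  qed
  obtain K where K: "K > 0" "\<And>x. norm (M x) \<le> norm x * K"
    using M.pos_bounded by blast
  \<comment> \<open>Minimises \<open>1 - 2 * t * c + t\<^sup>2 * K\<^sup>2\<close>, the bound for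
    the squared contraction factor; its minimum is \<open>1 - t * c\<close>.\<close>
  define t where "t = c / K\<^sup>2"
  have "t > 0"
    using \<open>c > 0\<close> K(1) by (simp add: t_def)
  have step: "(norm (x - t *\<^sub>R M x))\<^sup>2 \<le> (1 - t * c) * (norm x)\<^sup>2" for x
  proof -
    have "(norm (M x))\<^sup>2 \<le> (norm x * K)\<^sup>2"
      using K(2)[of x] by (intro power_mono) auto
    then have "t\<^sup>2 * (norm (M x))\<^sup>2 \<le> t\<^sup>2 * (norm x * K)\<^sup>2"
      by (intro mult_left_mono) auto
    also have "\<dots> = t * c * (norm x)\<^sup>2"
      using K(1) by (simp add: t_def power2_eq_square)
    finally have "(norm (x - t *\<^sub>R M x))\<^sup>2 \<le> (norm x)\<^sup>2 - 2 * t * rip (M x) x + t * c * (norm x)\<^sup>2"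
      by (simp add: norm_diff_squared rip_scaleR_right rip_commute[of x] power_mult_distrib)
    moreover have "t * (c * (norm x)\<^sup>2) \<le> t * rip (M x) x"
      using coercive[of x] \<open>t > 0\<close> by (intro mult_left_mono) auto
    ultimately show ?thesis
      by (simp add: algebra_simps)
  qed
  \<comment> \<open>The \<open>max 0\<close> keeps the radicand nonnegative without any comparison
    of \<open>c\<close> with \<open>K\<close>.\<close>
  define q where "q = sqrt (max 0 (1 - t * c))"
  have q: "0 \<le> q" "q < 1"
    using \<open>c > 0\<close> \<open>t > 0\<close> by (auto simp: q_def real_sqrt_lt_1_iff)
  have contr: "norm (x - t *\<^sub>R M x) \<le> q * norm x" for x
  proof (rule power2_le_imp_le)
    have "(1 - t * c) * (norm x)\<^sup>2 \<le> max 0 (1 - t * c) * (norm x)\<^sup>2"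
      by (intro mult_right_mono) auto
    with step[of x] show "(norm (x - t *\<^sub>R M x))\<^sup>2 \<le> (q * norm x)\<^sup>2"
      by (simp add: q_def power_mult_distrib)
  qed (use q in simp)
  have "\<exists>x. y = M x" for y
  proof -
    have "\<forall>u v. dist (u - t *\<^sub>R (M u - y)) (v - t *\<^sub>R (M v - y)) \<le> q * dist u v"
    proof (intro allI)
      fix u v
      have "(u - t *\<^sub>R (M u - y)) - (v - t *\<^sub>R (M v - y)) = (u - v) - t *\<^sub>R M (u - v)"
        by (simp add: M.diff scaleR_diff_right)
      with contr[of "u - v"] show "dist (u - t *\<^sub>R (M u - y)) (v - t *\<^sub>R (M v - y)) \<le> q * dist u v"
        by (simp only: dist_norm)
    qed
    from banach_fix_type[OF q this] obtain x where "x - t *\<^sub>R (M x - y) = x"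
      by auto
    with \<open>t > 0\<close> show ?thesis
      by auto
  qed
  then have "surj M"
    by (auto simp: surj_def)
  with \<open>inj M\<close> show "bij M"
    by (rule bijI)
qed

section \<open>Bessel sequences and synthesis on \<open>ell2\<close>\<close>

text \<open>Says that synthesis has norm at most \<open>K\<close>, phrased through finite sums so
  that no convergence is presupposed.\<close>

definition bessel :: "(nat \<Rightarrow> 'h) \<Rightarrow> real \<Rightarrow> bool" where
  "bessel r K \<longleftrightarrow> 0 \<le> K \<and>
    (\<forall>N c. norm (\<Sum>n<N. scaleK (c n) (r n)) \<le> K * L2_set (\<lambda>n. norm (c n)) {..<N})"

lemma besselD:
  "bessel r K \<Longrightarrow> norm (\<Sum>n<N. scaleK (c n) (r n)) \<le> K * L2_set (\<lambda>n. norm (c n)) {..<N}"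
  by (simp add: bessel_def)

text \<open>Synthesis and analysis are adjoint to each other, hence share their norm bounds. Each
  direction pairs a vector with a finite synthesis sum and cancels one factor of the resulting
  square.\<close>

lemma bessel_iff_analysis:
  "bessel r K \<longleftrightarrow> 0 \<le> K \<and> (\<forall>N h. L2_set (\<lambda>n. norm (ip h (r n))) {..<N} \<le> K * norm h)"
proof (cases "0 \<le> K")
  case K: True
  have "L2_set (\<lambda>n. norm (ip h (r n))) {..<N} \<le> K * norm h" if "bessel r K" for N h
  proof -
    \<comment> \<open>With these coefficients the pairing of \<open>h\<close> with the synthesis sum
      is the square of \<open>s\<close>.\<close>
    define c where "c n = ip h (r n)" for n
    define s where "s = L2_set (\<lambda>n. norm (c n)) {..<N}"
    have "ip h (\<Sum>n<N. scaleK (c n) (r n)) = of_real (\<Sum>n<N. (norm (c n))\<^sup>2)"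
      by (simp only: ip_sum_right ip_scale_right of_real_sum flip: mult_sconj_of_real)
        (simp add: c_def mult.commute)
    also have "(\<Sum>n<N. (norm (c n))\<^sup>2) = s\<^sup>2"
      by (simp add: s_def L2_set_def sum_nonneg)
    finally have "s\<^sup>2 \<le> norm h * norm (\<Sum>n<N. scaleK (c n) (r n))"
      using norm_ip_le[of h "\<Sum>n<N. scaleK (c n) (r n)"] by (simp add: norm_power)
    also have "\<dots> \<le> norm h * (K * s)"
      unfolding s_def by (intro mult_left_mono besselD that) auto
    finally have "s * s \<le> (K * norm h) * s"
      by (simp add: power2_eq_square mult_ac)
    moreover have "0 \<le> s"
      by (simp add: s_def)
    ultimately have "s \<le> K * norm h"
      using K by (cases "s = 0") auto
    then show ?thesis
      by (simp add: s_def c_def)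
  qed
  moreover have "norm (\<Sum>n<N. scaleK (c n) (r n)) \<le> K * L2_set (\<lambda>n. norm (c n)) {..<N}"
    if an: "\<And>N h. L2_set (\<lambda>n. norm (ip h (r n))) {..<N} \<le> K * norm h" for N c
  proof -
    define x where "x = (\<Sum>n<N. scaleK (c n) (r n))"
    have "ip x x = (\<Sum>n<N. c n * ip (r n) x)"
      by (subst x_def) (simp only: ip_sum_left ip_scale_left)
    then have "(norm x)\<^sup>2 = norm (\<Sum>n<N. c n * ip (r n) x)"
      by (metis ip_self norm_of_real abs_power2)
    also have "\<dots> \<le> (\<Sum>n<N. norm (c n * ip (r n) x))"
      by (rule norm_sum)
    also have "\<dots> = (\<Sum>n<N. \<bar>norm (c n)\<bar> * \<bar>norm (ip x (r n))\<bar>)"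
      by (metis (no_types, lifting) ip_commute norm_sconj norm_mult abs_norm_cancel)
    also have "\<dots> \<le> L2_set (\<lambda>n. norm (c n)) {..<N} * L2_set (\<lambda>n. norm (ip x (r n))) {..<N}"
      by (rule L2_set_mult_ineq)
    also have "\<dots> \<le> L2_set (\<lambda>n. norm (c n)) {..<N} * (K * norm x)"
      by (intro mult_left_mono an) simp
    finally have "norm x * norm x \<le> (K * L2_set (\<lambda>n. norm (c n)) {..<N}) * norm x"
      by (simp add: power2_eq_square mult_ac)
    then have "norm x \<le> K * L2_set (\<lambda>n. norm (c n)) {..<N}"
      using K by (cases "x = 0") auto
    then show ?thesis
      by (simp add: x_def)
  qed
  ultimately show ?thesis
    using K by (auto simp: bessel_def)
qed (simp add: bessel_def)

lemma bessel_ell2: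
  assumes "bessel r K"
  shows "(\<lambda>n. ip h (r n)) \<in> ell2" "ell2_norm (\<lambda>n. ip h (r n)) \<le> K * norm h"
  using assms by (auto simp: bessel_iff_analysis ell2_iff_L2_set_bounded intro: ell2_norm_le)

text \<open>A block of the series is a synthesis sum of a tail of \<open>c\<close>, and the tails
  tend to 0 in norm, so the partial sums are Cauchy.\<close>

lemma bessel_summable:
  assumes r: "bessel r K" and c: "c \<in> ell2"
  shows "summable (\<lambda>n. scaleK (c n) (r n))"
    and "norm (\<Sum>n. scaleK (c n) (r n)) \<le> K * ell2_norm c"
proof -
  have K: "0 \<le> K"
    using r by (simp add: bessel_def)
  let ?t = "\<lambda>M n. if n < M then 0 else c n"
  have seg: "norm (\<Sum>n=M..<N. scaleK (c n) (r n)) \<le> K * ell2_norm (?t M)" for M N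
  proof -
    have "(\<Sum>n=M..<N. scaleK (c n) (r n)) = (\<Sum>n<N. scaleK (?t M n) (r n))"
      by (rule sum.mono_neutral_cong_left) auto
    also have "norm \<dots> \<le> K * L2_set (\<lambda>n. norm (?t M n)) {..<N}"
      by (rule besselD[OF r])
    also have "\<dots> \<le> K * ell2_norm (?t M)"
      by (intro mult_left_mono L2_set_le_ell2_norm ell2_tail c K)
    finally show ?thesis .
  qed
  have lim: "(\<lambda>M. K * ell2_norm (?t M)) \<longlonglongrightarrow> 0"
    using tendsto_mult_right_zero[OF ell2_norm_tail_tendsto[OF c]] .
  show sm: "summable (\<lambda>n. scaleK (c n) (r n))"
    unfolding summable_Cauchy
  proof (intro allI impI)
    fix e :: real assume "0 < e"
    with order_tendstoD(2)[OF lim] obtain N where "\<forall>M\<ge>N. K * ell2_norm (?t M) < e"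
      by (auto simp: eventually_sequentially)
    then show "\<exists>N. \<forall>m\<ge>N. \<forall>n. norm (\<Sum>n=m..<n. scaleK (c n) (r n)) < e"
      using seg order_le_less_trans by blast
  qed
  show "norm (\<Sum>n. scaleK (c n) (r n)) \<le> K * ell2_norm c"
  proof (rule LIMSEQ_le_const2)
    show "(\<lambda>N. norm (\<Sum>n<N. scaleK (c n) (r n))) \<longlonglongrightarrow> norm (\<Sum>n. scaleK (c n) (r n))"
      by (intro tendsto_norm summable_LIMSEQ sm)
    show "\<exists>N. \<forall>n\<ge>N. norm (\<Sum>i<n. scaleK (c i) (r i)) \<le> K * ell2_norm c"
      using besselD[OF r] L2_set_le_ell2_norm[OF c] K
      by (meson mult_left_mono order_trans)
  qed
qed

text \<open>Take for \<open>r\<close> the images of the unit sequences. Linearity gives the formula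
  on truncations, and boundedness carries it to the limit because the tails vanish in norm.\<close>

lemma bounded_linear_ell2_synthesis:
  assumes R: "bounded_linear_ell2 scaleK R"
  obtains r K where "bessel r K" "\<And>c. c \<in> ell2 \<Longrightarrow> (\<lambda>n. scaleK (c n) (r n)) sums R c"
proof -
  obtain K0 where K0: "\<And>c. c \<in> ell2 \<Longrightarrow> norm (R c) \<le> K0 * ell2_norm c"
    using R unfolding bounded_linear_ell2_def by blast
  \<comment> \<open>The bound from the definition may be negative, whereas \<open>bessel\<close>
    asks for a nonnegative one.\<close>
  define K where "K = max K0 0"
  have K: "norm (R c) \<le> K * ell2_norm c" if "c \<in> ell2" for c
  proof -
    have "0 \<le> ell2_norm c"
      using that by (auto simp: ell2_norm_def ell2_def intro: suminf_nonneg)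
    then have "K0 * ell2_norm c \<le> K * ell2_norm c"
      by (intro mult_right_mono) (auto simp: K_def)
    with K0[OF that] show ?thesis
      by simp
  qed
  have add: "R (\<lambda>n. a n + b n) = R a + R b" if "a \<in> ell2" "b \<in> ell2" for a b
    using R that by (auto simp: bounded_linear_ell2_def)
  have scale: "R (\<lambda>n. x * a n) = scaleK x (R a)" if "a \<in> ell2" for a x
    using R that by (auto simp: bounded_linear_ell2_def)
  define e :: "nat \<Rightarrow> nat \<Rightarrow> 'k" where "e m n = (if n = m then 1 else 0)" for m n
  have e: "e m \<in> ell2" for m
    unfolding ell2_def mem_Collect_eq by (rule summable_finite[of "{m}"]) (auto simp: e_def)
  have ce: "(\<lambda>n. x * e m n) \<in> ell2" for m x
    unfolding ell2_def mem_Collect_eq by (rule summable_finite[of "{m}"]) (auto simp: e_def)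
  define r where "r m = R (e m)" for m
  have trunc: "R (\<lambda>n. if n < N then c n else 0) = (\<Sum>n<N. scaleK (c n) (r n))" for N and c :: "nat \<Rightarrow> 'k"
  proof (induction N)
    case 0
    show ?case
      using scale[OF e, of 0 0] by simp
  next
    case (Suc N)
    have "(\<lambda>n. if n < Suc N then c n else 0) = (\<lambda>n. (if n < N then c n else 0) + c N * e N n)"
      by (auto simp: e_def less_Suc_eq)
    with Suc show ?case
      by (simp add: add ell2_truncate ce scale e r_def)
  qed
  show thesis
  proof
    show "bessel r K"
      unfolding bessel_def
    proof (intro conjI allI)
      fix N and c :: "nat \<Rightarrow> 'k"
      let ?t = "\<lambda>n. if n < N then c n else 0"
      have "norm (\<Sum>n<N. scaleK (c n) (r n)) \<le> K * ell2_norm ?t"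
        using K[OF ell2_truncate] by (simp add: trunc)
      also have "(\<Sum>n. (norm (?t n))\<^sup>2) = (\<Sum>n<N. (norm (?t n))\<^sup>2)"
        by (rule suminf_finite) auto
      then have "ell2_norm ?t = L2_set (\<lambda>n. norm (c n)) {..<N}"
        by (simp add: ell2_norm_def L2_set_def)
      finally show "norm (\<Sum>n<N. scaleK (c n) (r n)) \<le> K * L2_set (\<lambda>n. norm (c n)) {..<N}" .
    qed (simp add: K_def)
  next
    fix c :: "nat \<Rightarrow> 'k" assume c: "c \<in> ell2"
    have "norm (R c - (\<Sum>n<N. scaleK (c n) (r n))) \<le> K * ell2_norm (\<lambda>n. if n < N then 0 else c n)"
      for N
    proof -
      have "c = (\<lambda>n. (if n < N then c n else 0) + (if n < N then 0 else c n))"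
        by auto
      then have "R c = (\<Sum>n<N. scaleK (c n) (r n)) + R (\<lambda>n. if n < N then 0 else c n)"
        using add[OF ell2_truncate[of N c] ell2_tail[OF c, of N]] by (simp add: trunc)
      then show ?thesis
        using K[OF ell2_tail[OF c, of N]] by simp
    qed
    then have "(\<lambda>N. R c - (\<Sum>n<N. scaleK (c n) (r n))) \<longlonglongrightarrow> 0"
      by (intro Lim_null_comparison[OF always_eventually tendsto_mult_right_zero[OF
            ell2_norm_tail_tendsto[OF c]]] allI)
    then show "(\<lambda>n. scaleK (c n) (r n)) sums R c"
      unfolding sums_def using tendsto_diff[OF tendsto_const[of "R c"]] by fastforce
  qed
qed

text \<open>Baire category: the sets on which the analysis coefficients have squared \<open>\<ell>\<^sup>2\<close> norm at most \<open>m\<close>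
  are closed and cover the space, so one of them contains a ball.\<close>

lemma bessel_of_ell2:
  assumes f: "\<And>h. (\<lambda>n. ip h (f n)) \<in> ell2"
  obtains D where "bessel f D"
proof -
  define p where "p N h = (\<Sum>n<N. (norm (ip h (f n)))\<^sup>2)" for N h
  define E where "E m = {h. \<forall>N. p N h \<le> real m}" for m
  have "closed (E m)" for m
  proof -
    have cont: "continuous_on UNIV (p N)" for N
      unfolding p_def
      by (intro continuous_on_sum continuous_on_power continuous_on_norm
          linear_continuous_on[OF bounded_linear_ip_left])
    have "E m = (\<Inter>N. {h. p N h \<le> real m})"
      by (auto simp: E_def)
    then show ?thesis
      using closed_Collect_le[OF cont continuous_on_const] by auto
  qed
  have cover: "\<Union>(range E) = UNIV"
  proof -
    have "\<exists>m. h \<in> E m" for h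
    proof -
      have "p N h \<le> (\<Sum>n. (norm (ip h (f n)))\<^sup>2)" for N
        unfolding p_def using f[of h] by (intro sum_le_suminf) (auto simp: ell2_def)
      moreover obtain m where "(\<Sum>n. (norm (ip h (f n)))\<^sup>2) \<le> real m"
        using real_arch_simple by blast
      ultimately show ?thesis
        unfolding E_def by (blast intro: order_trans)
    qed
    then show ?thesis
      by auto
  qed
  have "\<exists>m. interior (E m) \<noteq> {}"
  proof (rule ccontr)
    assume "\<not> ?thesis"
    then have "euclidean interior_of \<Union>(range E) = {}"
      using \<open>\<And>m. closed (E m)\<close>
      by (intro Baire_category_alt) (auto simp: completely_metrizable_space_euclidean)
    then show False
      by (simp add: cover)
  qed
  then obtain m x0 where "x0 \<in> interior (E m)"
    by blast
  then obtain d where d: "d > 0" "cball x0 d \<subseteq> E m"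
    by (auto simp: mem_interior_cball)
  have le: "p N (u - v) \<le> 2 * p N u + 2 * p N v" for N u v
  proof -
    have "(norm (ip (u - v) (f n)))\<^sup>2 \<le> 2 * (norm (ip u (f n)))\<^sup>2 + 2 * (norm (ip v (f n)))\<^sup>2" for n
    proof -
      have "(norm (ip (u - v) (f n)))\<^sup>2 \<le> (norm (ip u (f n)) + norm (ip v (f n)))\<^sup>2"
        by (intro power_mono) (auto simp: ip_diff_left norm_triangle_ineq4)
      moreover have "0 \<le> (norm (ip u (f n)) - norm (ip v (f n)))\<^sup>2"
        by simp
      ultimately show ?thesis
        by (simp add: power2_sum power2_diff)
    qed
    then show ?thesis
      unfolding p_def sum_distrib_left sum.distrib[symmetric] by (intro sum_mono)
  qed
  \<comment> \<open>The ball is moved to the origin by writing \<open>h\<close> as the difference of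
    \<open>x0 + h\<close> and \<open>x0\<close>, both in \<open>E m\<close>.\<close>
  have small: "p N h \<le> 4 * real m" if "norm h \<le> d" for N h
  proof -
    have "x0 + h \<in> E m" "x0 \<in> E m"
      using d that by (auto simp: subset_iff dist_norm)
    then have "p N (x0 + h) \<le> real m" "p N x0 \<le> real m"
      by (auto simp: E_def)
    then show ?thesis
      using le[of N "x0 + h" x0] by simp
  qed
  have "L2_set (\<lambda>n. norm (ip h (f n))) {..<N} \<le> (sqrt (4 * real m) / d) * norm h" for N h
  proof (cases "h = 0")
    case False
    \<comment> \<open>Rescales \<open>h\<close> to norm \<open>d\<close>, where \<open>small\<close>
      applies.\<close>
    define t where "t = d / norm h"
    have t: "t > 0"
      using False d by (simp add: t_def)
    have "p N (t *\<^sub>R h) \<le> 4 * real m"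
      using False d by (intro small) (simp add: t_def)
    also have "p N (t *\<^sub>R h) = t\<^sup>2 * p N h"
      by (simp add: p_def scaleR_eq_scaleK ip_scale_left norm_mult power_mult_distrib
          sum_distrib_left)
    finally have "sqrt (t\<^sup>2 * p N h) \<le> sqrt (4 * real m)"
      by (rule real_sqrt_le_mono)
    then have "t * sqrt (p N h) \<le> sqrt (4 * real m)"
      using t by (simp add: real_sqrt_mult)
    then have "sqrt (p N h) \<le> sqrt (4 * real m) / t"
      using t by (simp add: field_simps)
    then show ?thesis
      by (simp add: L2_set_def p_def t_def)
  qed (simp add: L2_set_def)
  then have "bessel f (sqrt (4 * real m) / d)"
    using d by (simp add: bessel_iff_analysis)
  then show thesis ..
qed

section \<open>Stability of recovery under perturbation\<close>

text \<open>The two mixed operators, analysis by one sequence followed by synthesis with the other,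
  are adjoint. This is checked on finite sums and passed to the limit.\<close>

lemma synthesis_swap:
  assumes "bessel r K" "bessel s D"
  shows "ip (\<Sum>n. scaleK (ip x (s n)) (r n)) y = ip x (\<Sum>n. scaleK (ip y (r n)) (s n))"
proof (rule LIMSEQ_unique)
  have "ip (\<Sum>n<N. scaleK (ip x (s n)) (r n)) y = ip x (\<Sum>n<N. scaleK (ip y (r n)) (s n))" for N
    unfolding ip_sum_left ip_sum_right ip_scale_left ip_scale_right
    by (intro sum.cong refl) (metis ip_commute mult.commute)
  then show "(\<lambda>N. ip (\<Sum>n<N. scaleK (ip x (s n)) (r n)) y)
      \<longlonglongrightarrow> ip x (\<Sum>n. scaleK (ip y (r n)) (s n))"
    using assms
    by (simp, intro tendsto_ip_right summable_LIMSEQ bessel_summable(1) bessel_ell2(1))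
  show "(\<lambda>N. ip (\<Sum>n<N. scaleK (ip x (s n)) (r n)) y)
      \<longlonglongrightarrow> ip (\<Sum>n. scaleK (ip x (s n)) (r n)) y"
    using assms by (intro tendsto_ip_left summable_LIMSEQ bessel_summable(1) bessel_ell2(1))
qed

text \<open>With \<open>q = sqrt lam\<close> the hypothesis gives
  \<open>norm (F - G) \<le> q * (norm F + norm G)\<close>. As \<open>q < 1\<close>, the term with
  \<open>G\<close> can be absorbed on the left, which bounds \<open>G\<close> by
  \<open>F\<close>.\<close>

lemma bessel_perturbation:
  assumes f: "bessel f D" and lam: "0 \<le> lam" "lam < 1"
    and close: "\<And>N c. (norm (\<Sum>n<N. scaleK (c n) (f n - g n)))\<^sup>2 \<le>
      lam * ((norm (\<Sum>n<N. scaleK (c n) (f n)))\<^sup>2 + (norm (\<Sum>n<N. scaleK (c n) (g n)))\<^sup>2)"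
  obtains D' where "bessel g D'"
proof -
  define q where "q = sqrt lam"
  have q: "0 \<le> q" "q < 1"
    using lam by (simp_all add: q_def real_sqrt_lt_1_iff)
  have "norm (\<Sum>n<N. scaleK (c n) (g n)) \<le> ((1 + q) / (1 - q) * D) * L2_set (\<lambda>n. norm (c n)) {..<N}"
    for N c
  proof -
    define F where "F = (\<Sum>n<N. scaleK (c n) (f n))"
    define G where "G = (\<Sum>n<N. scaleK (c n) (g n))"
    have "(norm (F - G))\<^sup>2 \<le> lam * ((norm F)\<^sup>2 + (norm G)\<^sup>2)"
      using close[of c N] by (simp add: F_def G_def scale_right_diff_distrib sum_subtractf)
    also have "\<dots> \<le> lam * (norm F + norm G)\<^sup>2"
      using lam by (intro mult_left_mono) (auto simp: power2_sum)
    also have "\<dots> = (q * (norm F + norm G))\<^sup>2"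
      using lam by (simp add: q_def power_mult_distrib)
    finally have "norm (F - G) \<le> q * (norm F + norm G)"
      by (rule power2_le_imp_le) (use q in simp)
    then have "norm G \<le> norm F + q * (norm F + norm G)"
      using norm_triangle_ineq2[of G F] by (simp add: norm_minus_commute)
    then have "(1 - q) * norm G \<le> (1 + q) * norm F"
      by (simp add: algebra_simps)
    then have "norm G \<le> (1 + q) / (1 - q) * norm F"
      using q by (simp add: field_simps)
    also have "\<dots> \<le> (1 + q) / (1 - q) * (D * L2_set (\<lambda>n. norm (c n)) {..<N})"
      unfolding F_def using q by (intro mult_left_mono besselD f) auto
    finally show ?thesis
      by (simp add: G_def mult.assoc)
  qed
  moreover have "0 \<le> (1 + q) / (1 - q) * D"
    using q f by (simp add: bessel_def)
  ultimately have "bessel g ((1 + q) / (1 - q) * D)"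
    by (simp add: bessel_def)
  then show thesis ..
qed

text \<open>The core of the argument, stated for arbitrary sequences \<open>f\<close> and
  \<open>g\<close> in place of operator orbits.\<close>

lemma recovery_perturbation:
  assumes f: "\<And>h. (\<lambda>n. ip h (f n)) \<in> ell2"
    and R: "bounded_linear_ell2 scaleK R" "\<And>h. R (\<lambda>n. ip h (f n)) = h"
    and lam: "0 \<le> lam" "lam < 1"
    and close: "\<And>N c. (norm (\<Sum>n<N. scaleK (c n) (f n - g n)))\<^sup>2 \<le>
      lam * ((norm (\<Sum>n<N. scaleK (c n) (f n)))\<^sup>2 + (norm (\<Sum>n<N. scaleK (c n) (g n)))\<^sup>2)"
  shows "(\<lambda>n. ip h (g n)) \<in> ell2"
    and "\<exists>R'. bounded_linear_ell2 scaleK R' \<and> (\<forall>h. R' (\<lambda>n. ip h (g n)) = h)"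
proof -
  obtain D where D: "bessel f D"
    using bessel_of_ell2[OF f] .
  obtain D' where D': "bessel g D'"
    using bessel_perturbation[OF D lam close] .
  show "(\<lambda>n. ip h (g n)) \<in> ell2"
    using bessel_ell2[OF D'] by simp
  obtain r K where r: "bessel r K" and sums: "\<And>c. c \<in> ell2 \<Longrightarrow> (\<lambda>n. scaleK (c n) (r n)) sums R c"
    using bounded_linear_ell2_synthesis[OF R(1)] by blast
  have R_eq: "R c = (\<Sum>n. scaleK (c n) (r n))" if "c \<in> ell2" for c
    using sums[OF that] by (simp add: sums_iff)
  have R_add: "R (\<lambda>n. a n + b n) = R a + R b" if "a \<in> ell2" "b \<in> ell2" for a b
    using R(1) that by (auto simp: bounded_linear_ell2_def)
  have R_scale: "R (\<lambda>n. x * a n) = scaleK x (R a)" if "a \<in> ell2" for a x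
    using R(1) that by (auto simp: bounded_linear_ell2_def)
  have R_le: "norm (R c) \<le> K * ell2_norm c" if "c \<in> ell2" for c
    using bessel_summable(2)[OF r that] by (simp add: R_eq that)
  \<comment> \<open>Applies the recovery operator for \<open>f\<close> to the coefficients against
    \<open>g\<close>; were the two sequences equal, \<open>M\<close> would be the identity.\<close>
  define M where "M h = R (\<lambda>n. ip h (g n))" for h
  note g2 = bessel_ell2(1)[OF D']
  have M_add: "M (x + y) = M x + M y" for x y
    by (simp add: M_def ip_add_left R_add g2)
  have M_scale: "M (scaleK c x) = scaleK c (M x)" for c x
    by (simp add: M_def ip_scale_left R_scale g2)
  have M_le: "norm (M x) \<le> norm x * (K * D')" for x
  proof -
    have "norm (M x) \<le> K * ell2_norm (\<lambda>n. ip x (g n))"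
      unfolding M_def by (intro R_le g2)
    also have "\<dots> \<le> K * (D' * norm x)"
      using r by (intro mult_left_mono bessel_ell2[OF D']) (simp add: bessel_def)
    finally show ?thesis
      by (simp add: mult_ac)
  qed
  have M_bl: "bounded_linear M"
    by (rule bounded_linear_intro[OF _ _ M_le]) (simp_all add: M_add M_scale scaleR_eq_scaleK)
  define c where "c = (1 - lam) / 2"
  have "c > 0"
    using lam by (simp add: c_def)
  have coercive: "c * (norm h)\<^sup>2 \<le> rip (M h) h" for h
  proof -
    let ?a = "\<lambda>n. ip h (r n)"
    define G where "G = (\<Sum>n. scaleK (?a n) (g n))"
    note a2 = bessel_ell2(1)[OF r, of h]
    \<comment> \<open>Dual form of the recovery identity: the adjoint of the identity map is the
      identity.\<close>
    have "(\<Sum>n. scaleK (?a n) (f n)) = h"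
    proof (rule ip_eqI)
      fix x
      have "ip x (\<Sum>n. scaleK (?a n) (f n)) = ip x h"
        using synthesis_swap[OF r D, of x h] R(2)[of x] by (simp add: R_eq f)
      then show "ip (\<Sum>n. scaleK (?a n) (f n)) x = ip h x"
        by (metis ip_commute)
    qed
    then have limF: "(\<lambda>N. \<Sum>n<N. scaleK (?a n) (f n)) \<longlonglongrightarrow> h"
      using summable_LIMSEQ[OF bessel_summable(1)[OF D a2]] by simp
    have limG: "(\<lambda>N. \<Sum>n<N. scaleK (?a n) (g n)) \<longlonglongrightarrow> G"
      unfolding G_def by (intro summable_LIMSEQ bessel_summable(1)[OF D' a2])
    have "(norm (h - G))\<^sup>2 \<le> lam * ((norm h)\<^sup>2 + (norm G)\<^sup>2)"
    proof (rule LIMSEQ_le)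
      show "(\<lambda>N. (norm ((\<Sum>n<N. scaleK (?a n) (f n)) - (\<Sum>n<N. scaleK (?a n) (g n))))\<^sup>2)
          \<longlonglongrightarrow> (norm (h - G))\<^sup>2"
        by (intro tendsto_intros limF limG)
      show "(\<lambda>N. lam * ((norm (\<Sum>n<N. scaleK (?a n) (f n)))\<^sup>2 + (norm (\<Sum>n<N. scaleK (?a n) (g n)))\<^sup>2))
          \<longlonglongrightarrow> lam * ((norm h)\<^sup>2 + (norm G)\<^sup>2)"
        by (intro tendsto_intros limF limG)
      show "\<exists>N. \<forall>n\<ge>N. (norm ((\<Sum>i<n. scaleK (?a i) (f i)) - (\<Sum>i<n. scaleK (?a i) (g i))))\<^sup>2
          \<le> lam * ((norm (\<Sum>i<n. scaleK (?a i) (f i)))\<^sup>2 + (norm (\<Sum>i<n. scaleK (?a i) (g i)))\<^sup>2)"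
        using close[of ?a] by (auto simp: scale_right_diff_distrib sum_subtractf)
    qed
    \<comment> \<open>Expanding the square on the left isolates \<open>rip h G\<close>; discarding
      the nonnegative term in \<open>G\<close> then leaves the constant \<open>c\<close>.\<close>
    then have "(1 - lam) * (norm h)\<^sup>2 + (1 - lam) * (norm G)\<^sup>2 \<le> 2 * rip h G"
      by (simp add: norm_diff_squared algebra_simps)
    moreover have "0 \<le> (1 - lam) * (norm G)\<^sup>2"
      using lam by simp
    moreover have "rip (M h) h = rip h G"
      using synthesis_swap[OF r D', of h h] by (intro rip_cong_ip) (simp add: M_def R_eq g2 G_def)
    ultimately show ?thesis
      by (simp add: c_def)
  qed
  have bij: "bij M" and lower: "c * norm x \<le> norm (M x)" for x
    using coercive_bij[OF M_bl \<open>c > 0\<close> coercive] by auto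
  define R' where "R' a = inv M (R a)" for a
  have M_inv: "M (inv M y) = y" for y
    using bij by (simp add: bij_is_surj surj_f_inv_f)
  \<comment> \<open>Linearity of \<open>R'\<close> is verified after applying the injective
    \<open>M\<close>.\<close>
  have inv_eqI: "inv M y = x" if "M x = y" for x y
    using that bij by (metis bij_is_inj inv_f_f)
  have "bounded_linear_ell2 scaleK R'"
    unfolding bounded_linear_ell2_def
  proof (intro conjI ballI allI exI)
    show "R' (\<lambda>n. a n + b n) = R' a + R' b" if "a \<in> ell2" "b \<in> ell2" for a b
      unfolding R'_def by (rule inv_eqI) (simp add: M_add M_inv R_add that)
    show "R' (\<lambda>n. x * a n) = scaleK x (R' a)" if "a \<in> ell2" for x a
      unfolding R'_def by (rule inv_eqI) (simp add: M_scale M_inv R_scale that)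
    show "norm (R' a) \<le> (K / c) * ell2_norm a" if "a \<in> ell2" for a
      using lower[of "R' a"] R_le[OF that] \<open>c > 0\<close>
      by (simp add: R'_def M_inv field_simps)
  qed
  moreover have "R' (\<lambda>n. ip h (g n)) = h" for h
    unfolding R'_def by (rule inv_eqI) (simp add: M_def)
  ultimately show "\<exists>R'. bounded_linear_ell2 scaleK R' \<and> (\<forall>h. R' (\<lambda>n. ip h (g n)) = h)"
    by blast
qed

end

section \<open>Application to the orbits of \<open>g\<close> under the two adjoints\<close>

theorem theorem4p3:
  fixes scaleK :: "'k::real_or_complex \<Rightarrow> 'h::banach \<Rightarrow> 'h"
    and ip :: "'h \<Rightarrow> 'h \<Rightarrow> 'k"
    and g :: 'h
    and A B :: "'h \<Rightarrow> 'h"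
  assumes "hilbert_space scaleK ip"
    and "separable_space (euclidean :: 'h topology)"
    and "bounded_operator scaleK A"
    and "bounded_operator scaleK B"
    and "stably_recoverable scaleK ip A g"
    and "\<forall>k::real. k > 0 \<longrightarrow>
      (\<exists>lam1 lam2 :: real. lam1 \<ge> 0 \<and> lam2 \<ge> 0 \<and> max lam1 lam2 < min 1 (2 powr (k - 1)) \<and>
        (\<forall>(l::nat) (a :: nat \<Rightarrow> 'k).
          norm (\<Sum>n=0..l. scaleK (a n) ((hilbert_adjoint ip A ^^ n) g - (hilbert_adjoint ip B ^^ n) g))
          \<le> (lam1 * norm (\<Sum>n=0..l. scaleK (a n) ((hilbert_adjoint ip A ^^ n) g)) powr k
             + lam2 * norm (\<Sum>n=0..l. scaleK (a n) ((hilbert_adjoint ip B ^^ n) g)) powr k)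
            powr (1 / k)))"
  shows "stably_recoverable scaleK ip B g"
proof -
  interpret hilbert_space scaleK ip by fact
  define f where "f n = (hilbert_adjoint ip A ^^ n) g" for n
  define f' where "f' n = (hilbert_adjoint ip B ^^ n) g" for n
  have ipA: "ip ((A ^^ n) h) g = ip h (f n)" for n h
    unfolding f_def by (rule ip_funpow_adjoint) fact
  have ipB: "ip ((B ^^ n) h) g = ip h (f' n)" for n h
    unfolding f'_def by (rule ip_funpow_adjoint) fact
  \<comment> \<open>The exponent 2 fits the Hilbert space geometry, and there the threshold
    \<open>min 1 (2 powr (k - 1))\<close> equals 1.\<close>
  have "2 powr (2 - 1) = (2::real)" by simp
  with assms(6)[rule_format, of 2] obtain lam1 lam2 :: real where lam: "lam1 \<ge> 0" "lam2 \<ge> 0" "max lam1 lam2 < 1"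
    and close: "\<And>l a. norm (\<Sum>n=0..l. scaleK (a n) (f n - f' n))
      \<le> (lam1 * norm (\<Sum>n=0..l. scaleK (a n) (f n)) powr 2
        + lam2 * norm (\<Sum>n=0..l. scaleK (a n) (f' n)) powr 2) powr (1 / 2)"
    unfolding f_def f'_def by auto
  define lm where "lm = max lam1 lam2"
  have close': "(norm (\<Sum>n<N. scaleK (c n) (f n - f' n)))\<^sup>2 \<le>
      lm * ((norm (\<Sum>n<N. scaleK (c n) (f n)))\<^sup>2 + (norm (\<Sum>n<N. scaleK (c n) (f' n)))\<^sup>2)" for N c
  \<comment> \<open>The hypothesis sums over \<open>0..l\<close>, which is the range below
    \<open>Suc l\<close>; for \<open>N = 0\<close> both sides vanish.\<close>
  proof (cases N)
    case (Suc l)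
    define x where "x = lam1 * (norm (\<Sum>n<N. scaleK (c n) (f n)))\<^sup>2
      + lam2 * (norm (\<Sum>n<N. scaleK (c n) (f' n)))\<^sup>2"
    have "0 \<le> x"
      using lam by (simp add: x_def)
    have "norm (\<Sum>n<N. scaleK (c n) (f n - f' n)) \<le> sqrt x"
      using close[of c l] \<open>0 \<le> x\<close>
      by (simp add: Suc x_def lessThan_Suc_atMost atMost_atLeast0 powr_half_sqrt)
    then have "(norm (\<Sum>n<N. scaleK (c n) (f n - f' n)))\<^sup>2 \<le> (sqrt x)\<^sup>2"
      by (intro power_mono) auto
    also have "\<dots> = x"
      using \<open>0 \<le> x\<close> by simp
    also have "\<dots> \<le> lm * (norm (\<Sum>n<N. scaleK (c n) (f n)))\<^sup>2
        + lm * (norm (\<Sum>n<N. scaleK (c n) (f' n)))\<^sup>2"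
      unfolding x_def by (intro add_mono mult_right_mono) (auto simp: lm_def)
    finally show ?thesis
      by (simp add: distrib_left)
  qed simp
  obtain R where R: "bounded_linear_ell2 scaleK R" "\<And>h. R (\<lambda>n. ip h (f n)) = h"
    and f2: "\<And>h. (\<lambda>n. ip h (f n)) \<in> ell2"
    using assms(5) by (auto simp: stably_recoverable_def ipA)
  have "0 \<le> lm" "lm < 1"
    using lam by (auto simp: lm_def)
  from recovery_perturbation[OF f2 R this close'] show ?thesis
    by (auto simp: stably_recoverable_def ipB)
qed

end
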